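(* Let $\Xi\subset\mathbb{R}$ be an open set containing $0$, let $f\in C^4(\mathbb{R})$ be a probability density function on $\mathbb{R}$, and let $\mathcal{S}_f$ be the location-scale-shape model generated by $f$, with $\mathcal{S}_f\subset\mathcal{P}_2(\mathbb{R})$. Then $\mathcal{S}_f$ is not totally geodesic in $\mathcal{P}_2(\mathbb{R})$ with respect to the $L^2$-Wasserstein distance; that is, $\mathcal{S}_f$ is not closed under displacement interpolation.
   Context: Location-scale-shape model generated by $f$: $\mathcal{S}_f=\{p(\cdot;\theta)\mid \theta=(\mu,\sigma,\xi)\in\mathbb{R}\times\mathbb{R}_{>0}\times\Xi\}$, where, for $\xi\neq 0$, $p(x;\theta)=\frac1\sigma\left(1+\xi\frac{x-\mu}{\sigma}\right)^{-1}f\left(\frac1\xi\log\left(1+\xi\frac{x-\mu}{\sigma}\right)\right)$ if $1+\xi\frac{x-\mu}{\sigma}>0$ and $p(x;\theta)=0$ otherwise; and, for $\xi=0$, $p(x;\theta)=\frac1\sigma f\left(\frac{x-\mu}{\sigma}\right)$. $\mathcal{P}_2(\mathbb{R})$ is the set of Borel probability measures on $\mathbb{R}$ with finite second moment, with the $L^2$-Wasserstein distance; densities are identified with the measures they define. Displacement interpolation: for $p_1,p_2\in\mathcal{S}_f$ with cumulative distribution functions $P_1,P_2$, let $T=P_2^{-1}\circ P_1$ (with $P_2^{-1}$ the quantile function) be the optimal transport map from $p_1$ to $p_2$. The displacement interpolation (the $L^2$-Wasserstein geodesic) is $p_t=\left((1-t)\,\mathrm{id}+tT\right)_{\#}p_1$,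 $t\in[0,1]$; equivalently its quantile function is $(1-t)P_1^{-1}+tP_2^{-1}$. A subset $\mathcal{S}\subset\mathcal{P}_2(\mathbb{R})$ is called totally geodesic (closed under displacement interpolation) if $p_t\in\mathcal{S}$ for all $p_1,p_2\in\mathcal{S}$ and all $t\in[0,1]$. *)

theory Defs
  imports "HOL-Probability.Probability"
begin

definition Ck_real :: "nat \<Rightarrow> (real \<Rightarrow> real) \<Rightarrow> bool" where
  "Ck_real k f \<longleftrightarrow>
     (\<forall>j<k. (deriv ^^ j) f differentiable_on UNIV) \<and> continuous_on UNIV ((deriv ^^ k) f)"

definition density_measure :: "(real \<Rightarrow> real) \<Rightarrow> real measure" where
  "density_measure p = density lborel (\<lambda>x. ennreal (p x))"

text \<open>Nonnegativity is required separately because \<^const>\<open>ennreal\<close> truncates negative values to 0.\<close>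

definition probability_density :: "(real \<Rightarrow> real) \<Rightarrow> bool" where
  "probability_density p \<longleftrightarrow>
     p \<in> borel_measurable borel \<and> (\<forall>x. 0 \<le> p x) \<and> prob_space (density_measure p)"

definition lss_density :: "(real \<Rightarrow> real) \<Rightarrow> real \<Rightarrow> real \<Rightarrow> real \<Rightarrow> real \<Rightarrow> real" where
  "lss_density f \<mu> \<sigma> \<xi> x =
     (if \<xi> = 0 then 1 / \<sigma> * f ((x - \<mu>) / \<sigma>)
      else if 1 + \<xi> * ((x - \<mu>) / \<sigma>) > 0
      then 1 / \<sigma> * inverse (1 + \<xi> * ((x - \<mu>) / \<sigma>))
             * f (1 / \<xi> * ln (1 + \<xi> * ((x - \<mu>) / \<sigma>)))
      else 0)"

definition lss_model :: "(real \<Rightarrow> real) \<Rightarrow> real set \<Rightarrow> real measure set" where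
  "lss_model f \<Xi> = {density_measure (lss_density f \<mu> \<sigma> \<xi>) | \<mu> \<sigma> \<xi>. \<sigma> > 0 \<and> \<xi> \<in> \<Xi>}"

definition P2_space :: "real measure set" where
  "P2_space = {M. prob_space M \<and> sets M = sets borel \<and> integrable M (\<lambda>x. x\<^sup>2)}"

text \<open>The quantile function is meaningful for \<open>0 < u < 1\<close>. At \<open>u = 0\<close> and, if \<open>M\<close> is not bounded
  above, at \<open>u = 1\<close> the infimum is taken over an unbounded or an empty set and is an arbitrary real.\<close>

definition quantile :: "real measure \<Rightarrow> real \<Rightarrow> real" where
  "quantile M u = Inf {x. u \<le> cdf M x}"

text \<open>If \<open>M\<close> has a density, then \<open>cdf M\<close> takes the values 0 and 1 only on an \<open>M\<close>-null set, so the
  arbitrary values of the quantile function do not affect the pushforward below. The map is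
  nondecreasing where \<open>0 < cdf M < 1\<close> and constant on each of the two remaining sets, so it is
  Borel measurable and \<^const>\<open>distr\<close> is the genuine pushforward.\<close>

definition transport_map :: "real measure \<Rightarrow> real measure \<Rightarrow> real \<Rightarrow> real" where
  "transport_map M N = quantile N \<circ> cdf M"

definition displacement_interpolation ::
    "real measure \<Rightarrow> real measure \<Rightarrow> real \<Rightarrow> real measure" where
  "displacement_interpolation M N t =
     distr M borel (\<lambda>x. (1 - t) * x + t * transport_map M N x)"

text \<open>Closure under displacement interpolation; intended for sets of atomless measures contained in
  \<^const>\<open>P2_space\<close>, for which the transport map above is optimal.\<close>

definition totally_geodesic :: "real measure set \<Rightarrow> bool" where
  "totally_geodesic S \<longleftrightarrow>
     (\<forall>p\<^sub>1\<in>S. \<forall>p\<^sub>2\<in>S. \<forall>t\<in>{0..1}. displacement_interpolation p\<^sub>1 p\<^sub>2 t \<in> S)"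

end

theory Submission
  imports Defs
begin

text \<open>Write \<open>g\<^sub>\<xi> y = (exp (\<xi> y) - 1) / \<xi>\<close>, and \<open>g\<^sub>0 y = y\<close>. The model consists of the laws of
  \<open>\<mu> + \<sigma> g\<^sub>\<xi> Y\<close>, where \<open>Y\<close> has density \<open>f\<close>. The midpoint of the interpolation between the laws of \<open>Y\<close>
  and of \<open>g\<^sub>a Y\<close>, \<open>a \<noteq> 0\<close>, is the law of \<open>(Y + g\<^sub>a Y) / 2\<close>. If it were the law of \<open>\<mu> + \<sigma> g\<^sub>b Y\<close>,
  comparing distribution functions would give \<open>(y + g\<^sub>a y) / 2 = \<mu> + \<sigma> g\<^sub>b y\<close> on an open interval on
  which \<open>f > 0\<close>, and differentiating twice shows that this is impossible.\<close>

section \<open>Shape maps and the model densities\<close>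

definition shape_map :: "real \<Rightarrow> real \<Rightarrow> real" where
  "shape_map \<xi> y = (if \<xi> = 0 then y else (exp (\<xi> * y) - 1) / \<xi>)"

text \<open>The formula covers \<xi> = 0 as well, so arguments through derivatives need no case
  distinction later.\<close>

lemma has_real_derivative_shape_map:
  "(shape_map \<xi> has_real_derivative exp (\<xi> * y)) (at y within A)"
proof (cases "\<xi> = 0")
  case True
  then have "shape_map \<xi> = (\<lambda>y. y)" by (auto simp: shape_map_def)
  with True show ?thesis by simp
next
  case False
  then have "shape_map \<xi> = (\<lambda>y. (exp (\<xi> * y) - 1) / \<xi>)" by (auto simp: shape_map_def)
  with False show ?thesis by (auto intro!: derivative_eq_intros)
qed

lemma isCont_shape_map: "isCont (shape_map \<xi>) y"
  using has_real_derivative_shape_map DERIV_isCont by blast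

lemma strict_mono_shape_map: "strict_mono (shape_map \<xi>)"
proof (rule strict_monoI)
  fix x y :: real assume "x < y"
  then show "shape_map \<xi> x < shape_map \<xi> y"
    by (rule DERIV_pos_imp_increasing) (meson exp_gt_zero has_real_derivative_shape_map)
qed

lemma strict_mono_affine_shape_map:
  assumes "\<sigma> > 0"
  shows "strict_mono (\<lambda>y. \<mu> + \<sigma> * shape_map \<xi> y)"
  using assms strict_mono_shape_map[of \<xi>] by (auto simp: strict_mono_def)

text \<open>At z = \<mu> + \<sigma> * \<open>shape_map \<xi> y\<close> with \<xi> nonzero, 1 + \<xi>
  (z - \<mu>) / \<sigma> equals \<open>exp (\<xi> * y)\<close>: the logarithm inside the density
  returns y, and the prefactor is the reciprocal of the Jacobian.\<close>

lemma lss_density_shape_map: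
  assumes "\<sigma> > 0"
  shows "\<sigma> * exp (\<xi> * y) * lss_density f \<mu> \<sigma> \<xi> (\<mu> + \<sigma> * shape_map \<xi> y) = f y"
  using assms by (cases "\<xi> = 0") (simp_all add: lss_density_def shape_map_def)

text \<open>Where the density is nonzero, the argument of \<open>f\<close> in its definition is a
  preimage of z under the affine shape map.\<close>

lemma lss_density_outside_range:
  assumes "\<sigma> > 0" and "z \<notin> range (\<lambda>y. \<mu> + \<sigma> * shape_map \<xi> y)"
  shows "lss_density f \<mu> \<sigma> \<xi> z = 0"
proof (rule ccontr)
  define w where "w = 1 + \<xi> * ((z - \<mu>) / \<sigma>)"
  assume nz: "lss_density f \<mu> \<sigma> \<xi> z \<noteq> 0"
  have "z = \<mu> + \<sigma> * shape_map \<xi> (if \<xi> = 0 then (z - \<mu>) / \<sigma> else 1 / \<xi> * ln w)"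
  proof (cases "\<xi> = 0")
    case True
    with assms(1) show ?thesis by (simp add: shape_map_def)
  next
    case False
    then have "w > 0" using nz by (auto simp: lss_density_def w_def split: if_splits)
    with False have "shape_map \<xi> (1 / \<xi> * ln w) = (z - \<mu>) / \<sigma>"
      by (simp add: shape_map_def) (simp add: w_def)
    with False assms(1) show ?thesis by simp
  qed
  with assms(2) show False by blast
qed

lemma lss_density_nonneg:
  assumes "\<And>x. 0 \<le> f x" and "\<sigma> > 0"
  shows "0 \<le> lss_density f \<mu> \<sigma> \<xi> z"
  using assms by (auto simp: lss_density_def)

lemma borel_measurable_lss_density [measurable]:
  assumes [measurable]: "f \<in> borel_measurable borel"
  shows "lss_density f \<mu> \<sigma> \<xi> \<in> borel_measurable borel"
  unfolding lss_density_def by measurable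

lemma lss_density_standard: "lss_density f 0 1 0 = f"
  by (auto simp: lss_density_def)

section \<open>Distribution functions of the model members\<close>

lemma sets_density_measure [simp]: "sets (density_measure p) = sets borel"
  by (simp add: density_measure_def)

text \<open>With the indicator inside \<open>ennreal\<close>, the integrand comes from a real
  function, to which results on the gauge integral apply.\<close>

lemma emeasure_density_measure:
  assumes [measurable]: "p \<in> borel_measurable borel" "A \<in> sets borel"
    and "\<And>x. 0 \<le> p x"
  shows "emeasure (density_measure p) A = (\<integral>\<^sup>+x. ennreal (p x * indicator A x) \<partial>lborel)"
  unfolding density_measure_def
  by (subst emeasure_density) (auto intro!: nn_integral_cong simp: indicator_def)

text \<open>Change of variables along the increasing affine shape map pulls the integral of the
  model density up to the image of x back to the integral of \<open>f\<close> up to x. In effect,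
  the map transports the law of \<open>f\<close> to the member of the model.\<close>

lemma cdf_lss_density:
  assumes f: "probability_density f" and "\<sigma> > 0"
  shows "cdf (density_measure (lss_density f \<mu> \<sigma> \<xi>)) (\<mu> + \<sigma> * shape_map \<xi> x)
    = cdf (density_measure f) x"
proof -
  have [measurable]: "f \<in> borel_measurable borel" and f0: "\<And>x. 0 \<le> f x"
    and "prob_space (density_measure f)"
    using f by (auto simp: probability_density_def)
  then interpret M: prob_space "density_measure f" by simp
  define \<phi> where "\<phi> y = \<mu> + \<sigma> * shape_map \<xi> y" for y
  have mono: "strict_mono \<phi>"
    unfolding \<phi>_def using \<open>\<sigma> > 0\<close> by (rule strict_mono_affine_shape_map)
  define p where "p = lss_density f \<mu> \<sigma> \<xi>"
  define q where "q z = p z * indicator {..\<phi> x} z" for z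
  have [measurable]: "p \<in> borel_measurable borel" by (simp add: p_def)
  have p0: "\<And>z. 0 \<le> p z" using lss_density_nonneg[OF f0 \<open>\<sigma> > 0\<close>] by (simp add: p_def)
  let ?F = "cdf (density_measure f) x"
  have "((\<lambda>y. f y * indicator {..x} y) has_integral ?F) UNIV"
    using f0 by (intro nn_integral_has_integral)
      (auto simp: emeasure_density_measure[symmetric] cdf_def M.emeasure_eq_measure)
  moreover have "\<bar>\<sigma> * exp (\<xi> * y)\<bar> * q (\<phi> y) = f y * indicator {..x} y" for y
    using lss_density_shape_map[OF \<open>\<sigma> > 0\<close>, of \<xi> y f \<mu>] \<open>\<sigma> > 0\<close> strict_mono_less_eq[OF mono]
    by (auto simp: q_def p_def \<phi>_def abs_mult indicator_def)
  ultimately have I: "((\<lambda>y. \<bar>\<sigma> * exp (\<xi> * y)\<bar> * q (\<phi> y)) has_integral ?F) UNIV"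
    by simp
  \<comment> \<open>The change of variables asks for absolute integrability, which an integrable
    nonnegative function has.\<close>
  have "(\<lambda>y. \<bar>\<sigma> * exp (\<xi> * y)\<bar> * q (\<phi> y)) absolutely_integrable_on UNIV"
    using I p0 by (intro nonnegative_absolutely_integrable_1) (auto simp: q_def)
  moreover have "(\<phi> has_field_derivative \<sigma> * exp (\<xi> * y)) (at y within UNIV)" for y
    unfolding \<phi>_def by (auto intro!: derivative_eq_intros has_real_derivative_shape_map)
  moreover have "inj_on \<phi> UNIV" using mono by (rule strict_mono_imp_inj_on)
  ultimately have "q absolutely_integrable_on range \<phi>" "integral (range \<phi>) q = ?F"
    using has_absolute_integral_change_of_variables_1'[of UNIV \<phi> "\<lambda>y. \<sigma> * exp (\<xi> * y)" q ?F]
      integral_unique[OF I] by auto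
  then have "(q has_integral ?F) (range \<phi>)"
    by (metis absolutely_integrable_on_def integrable_integral)
  \<comment> \<open>The substitution covers only the range of \<phi>, possibly a half-line; no mass
    lies outside.\<close>
  moreover have "q z = 0" if "z \<notin> range \<phi>" for z
    using lss_density_outside_range[OF \<open>\<sigma> > 0\<close>] that by (auto simp: q_def p_def \<phi>_def)
  ultimately have "(q has_integral ?F) UNIV"
    by (rule has_integral_on_superset) auto
  then have "(\<integral>\<^sup>+z. ennreal (q z) \<partial>lborel) = ?F"
    using p0 by (intro nn_integral_has_integral_lborel) (auto simp: q_def[abs_def])
  then have "emeasure (density_measure p) {..\<phi> x} = ennreal ?F"
    using p0 by (simp add: emeasure_density_measure q_def)
  then have "cdf (density_measure p) (\<phi> x) = ?F"
    by (simp add: cdf_def measure_def)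
  then show ?thesis by (simp add: p_def \<phi>_def)
qed

text \<open>If the piece between x and y had no mass, \<open>f\<close> would vanish almost
  everywhere on it; being positive there, it would force the piece to have length zero.\<close>

lemma cdf_density_measure_strict_mono:
  assumes f: "probability_density f" and pos: "\<And>x. x \<in> {l<..<r} \<Longrightarrow> 0 < f x"
    and xy: "x \<in> {l<..<r}" "y \<in> {l<..<r}" "x < y"
  shows "cdf (density_measure f) x < cdf (density_measure f) y"
proof -
  have [measurable]: "f \<in> borel_measurable borel" and f0: "\<And>x. 0 \<le> f x"
    and "prob_space (density_measure f)"
    using f by (auto simp: probability_density_def)
  then interpret M: real_distribution "density_measure f"
    by (simp add: real_distribution_def real_distribution_axioms_def)
  have "emeasure (density_measure f) {x<..y} \<noteq> 0"
  proof
    assume "emeasure (density_measure f) {x<..y} = 0"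
    then have "AE z in lborel. f z * indicator {x<..y} z = 0"
      using f0 by (subst (asm) emeasure_density_measure)
        (auto simp: nn_integral_0_iff_AE indicator_def order_antisym_conv)
    then have "AE z in lborel. z \<notin> {x<..y}"
    proof eventually_elim
      case (elim z)
      then show ?case using pos[of z] xy by (auto simp: indicator_def split: if_splits)
    qed
    then have "emeasure lborel {x<..y} = 0"
      by (subst (asm) AE_iff_measurable[where N = "{x<..y}"]) auto
    with xy show False by simp
  qed
  then have "measure (density_measure f) {x<..y} > 0"
    by (simp add: M.emeasure_eq_measure zero_less_measure_iff)
  then show ?thesis using M.cdf_diff_eq[OF xy(3)] by simp
qed

lemma isCont_cdf_density_measure:
  assumes f: "probability_density f"
  shows "isCont (cdf (density_measure f)) x"
proof -
  have [measurable]: "f \<in> borel_measurable borel" and "prob_space (density_measure f)"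
    using f by (auto simp: probability_density_def)
  then interpret M: real_distribution "density_measure f"
    by (simp add: real_distribution_def real_distribution_axioms_def)
  have "AE z in lborel. ennreal (f z) * indicator {x} z = 0"
    using AE_lborel_singleton[of x] by eventually_elim (simp add: indicator_def)
  then have "emeasure (density_measure f) {x} = 0"
    unfolding density_measure_def by (subst emeasure_density) (simp_all add: nn_integral_0_iff_AE)
  then show ?thesis by (simp add: M.isCont_cdf measure_def)
qed

section \<open>Extreme levels, quantile functions, and points determined by their level\<close>

context real_distribution
begin

text \<open>By continuity the zero set of the distribution function is closed, so it contains its
  supremum, and the half-line up to there is null. Levels 0 and 1 must be discarded because the
  quantile function is controlled only between them.\<close>

lemma AE_cdf_pos:
  assumes cont: "\<And>x. isCont (cdf M) x"
  shows "AE x in M. 0 < cdf M x"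
proof (cases "{x. cdf M x = 0} = {}")
  case True
  then show ?thesis using cdf_nonneg by (auto simp: less_le)
next
  case False
  let ?A = "{x. cdf M x = 0}"
  have "\<forall>\<^sub>F x in at_top. 0 < cdf M x"
    using cdf_lim_at_top_prob by (rule order_tendstoD) simp
  then obtain y where y: "0 < cdf M y" by (meson eventually_at_top_linorder order_refl)
  have bdd: "bdd_above ?A"
  proof (rule bdd_aboveI)
    fix x assume "x \<in> ?A"
    with y cdf_nondecreasing[of y x] show "x \<le> y" by force
  qed
  have "closed ?A"
    using continuous_closed_vimage[of "{0}" "cdf M"] cont by (simp add: vimage_def)
  then have "cdf M (Sup ?A) = 0"
    using closed_contains_Sup[OF False bdd] by simp
  then have "{..Sup ?A} \<in> null_sets M"
    by (simp add: cdf_def emeasure_eq_measure null_sets_def)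
  moreover have "{x \<in> space M. \<not> 0 < cdf M x} \<subseteq> {..Sup ?A}"
  proof
    fix x assume "x \<in> {x \<in> space M. \<not> 0 < cdf M x}"
    then have "x \<in> ?A" using cdf_nonneg[of x] by simp
    then show "x \<in> {..Sup ?A}" using cSup_upper[OF _ bdd] by simp
  qed
  ultimately show ?thesis by (rule AE_I')
qed

lemma AE_cdf_less_1:
  assumes cont: "\<And>x. isCont (cdf M) x"
  shows "AE x in M. cdf M x < 1"
proof (cases "{x. cdf M x = 1} = {}")
  case True
  then show ?thesis using cdf_bounded_prob by (auto simp: less_le)
next
  case False
  let ?A = "{x. cdf M x = 1}"
  have "\<forall>\<^sub>F x in at_bot. cdf M x < 1"
    using cdf_lim_at_bot by (rule order_tendstoD) simp
  then obtain y where y: "cdf M y < 1" by (meson eventually_at_bot_linorder order_refl)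
  have bdd: "bdd_below ?A"
  proof (rule bdd_belowI)
    fix x assume "x \<in> ?A"
    with y cdf_nondecreasing[of x y] show "y \<le> x" by force
  qed
  have "closed ?A"
    using continuous_closed_vimage[of "{1}" "cdf M"] cont by (simp add: vimage_def)
  then have "cdf M (Inf ?A) = 1"
    using closed_contains_Inf[OF False bdd] by simp
  then have "AE x in M. x \<in> {..Inf ?A}"
    by (simp add: cdf_def prob_eq_1)
  \<comment> \<open>The half-line of full mass still contains its endpoint, where the level is 1;
    continuity makes that point null.\<close>
  moreover have "measure M {Inf ?A} = 0" using cont isCont_cdf by blast
  then have "AE x in M. x \<notin> {Inf ?A}"
    by (simp add: emeasure_eq_measure AE_iff_measurable[OF _ refl])
  ultimately show ?thesis
  proof eventually_elim
    case (elim x)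
    then have "x \<notin> ?A" using cInf_lower[OF _ bdd, of x] by auto
    then show ?case using cdf_bounded_prob[of x] by simp
  qed
qed

text \<open>Strictly between 0 and 1 the superlevel sets are nonempty and bounded below, so the
  infima are genuine, and the sets shrink as the level grows.\<close>

lemma mono_on_quantile: "mono_on {0<..<1} (quantile M)"
proof (rule mono_onI)
  fix u v :: real assume uv: "u \<in> {0<..<1}" "v \<in> {0<..<1}" "u \<le> v"
  have "\<forall>\<^sub>F x in at_top. v < cdf M x"
    using uv by (intro order_tendstoD(1)[OF cdf_lim_at_top_prob]) simp
  then obtain y where "v < cdf M y" by (meson eventually_at_top_linorder order_refl)
  then have ne: "{x. v \<le> cdf M x} \<noteq> {}" by (auto intro: less_imp_le)
  have "\<forall>\<^sub>F x in at_bot. cdf M x < u"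
    using uv by (intro order_tendstoD(2)[OF cdf_lim_at_bot]) simp
  then obtain z where z: "cdf M z < u" by (meson eventually_at_bot_linorder order_refl)
  have "bdd_below {x. u \<le> cdf M x}"
  proof (rule bdd_belowI)
    fix x assume "x \<in> {x. u \<le> cdf M x}"
    with z cdf_nondecreasing[of x z] show "z \<le> x" by force
  qed
  then show "quantile M u \<le> quantile M v"
    unfolding quantile_def using ne uv by (intro cInf_superset_mono) auto
qed

lemma borel_measurable_quantile: "quantile M \<in> borel_measurable borel"
\<comment> \<open>The function is monotone on each piece, being constant on the outer two. Level 1
  stands alone: if it is not attained, the value there is arbitrary.\<close>
proof (rule measurable_piecewise_restrict[where C = "{{..0}, {0<..<1}, {1}, {1<..}}"])
  have "{x. u \<le> cdf M x} = UNIV" if "u \<le> 0" for u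
    using that cdf_nonneg by (auto intro: order_trans)
  then have "mono_on {..0} (quantile M)" by (auto simp: mono_on_def quantile_def)
  moreover have "{x. u \<le> cdf M x} = {}" if "u > 1" for u
    using that cdf_bounded_prob by (auto simp: not_le intro: le_less_trans)
  then have "mono_on {1<..} (quantile M)" by (auto simp: mono_on_def quantile_def)
  ultimately show "quantile M \<in> borel_measurable (restrict_space borel \<Omega>)"
    if "\<Omega> \<in> {{..0}, {0<..<1}, {1}, {1<..}}" for \<Omega>
    using that mono_on_quantile by (auto intro!: borel_measurable_mono_on_fnc simp: mono_on_def)
  show "space borel \<subseteq> \<Union> {{..0}, {0<..<1}, {1}, {(1::real)<..}}"
    by (auto simp: not_le)
qed auto

end

text \<open>Strict growth of \<open>F\<close> only near \<open>x\<close> suffices to exclude that \<open>cdf N\<close> has a flat piece at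
  the level \<open>F x\<close>.\<close>

lemma cdf_eq_imp_eq:
  assumes N: "real_distribution N" and cdf: "\<And>y. y \<in> {l<..<r} \<Longrightarrow> cdf N (\<phi> y) = F y"
    and F: "strict_mono_on {l<..<r} F" and cont: "isCont \<phi> x"
    and x: "x \<in> {l<..<r}" and z: "cdf N z = F x"
  shows "z = \<phi> (x::real)"
proof (rule ccontr)
  interpret N: real_distribution N by fact
  have tend: "(\<phi> \<longlongrightarrow> \<phi> x) (at_left x)" "(\<phi> \<longlongrightarrow> \<phi> x) (at_right x)"
    using cont by (auto simp: isCont_def filterlim_at_split)
  assume "z \<noteq> \<phi> x"
  then consider "z < \<phi> x" | "\<phi> x < z" by linarith
  then show False
  proof cases
    case 1
    \<comment> \<open>A point y slightly left of x keeps \<phi> y above z, so \<open>cdf N z\<close>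
      is at most \<open>F y\<close>, which is less than \<open>F x\<close>. The other case mirrors
      this on the right.\<close>
    have "\<forall>\<^sub>F y in at_left x. z < \<phi> y" using order_tendstoD(1)[OF tend(1) 1] .
    moreover have "\<forall>\<^sub>F y in at_left x. y \<in> {l<..<x}"
      using x by (intro eventually_at_left_real) auto
    ultimately obtain y where "z < \<phi> y" "y \<in> {l<..<x}"
      using eventually_happens'[OF trivial_limit_at_left_real] eventually_conj by blast
    moreover from this have "F y < F x" using x by (intro strict_mono_onD[OF F]) auto
    ultimately show False
      using N.cdf_nondecreasing[of z "\<phi> y"] cdf[of y] z x by auto
  next
    case 2
    have "\<forall>\<^sub>F y in at_right x. \<phi> y < z" using order_tendstoD(2)[OF tend(2) 2] .
    moreover have "\<forall>\<^sub>F y in at_right x. y \<in> {x<..<r}"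
      using x by (intro eventually_at_right_real) auto
    ultimately obtain y where "\<phi> y < z" "y \<in> {x<..<r}"
      using eventually_happens'[OF trivial_limit_at_right_real] eventually_conj by blast
    moreover from this have "F x < F y" using x by (intro strict_mono_onD[OF F]) auto
    ultimately show False
      using N.cdf_nondecreasing[of "\<phi> y" z] cdf[of y] z x by auto
  qed
qed

text \<open>Since \<open>cdf N\<close> first reaches the level \<open>F x\<close> at \<phi> x, the
  superlevel set is the closed half-line starting there.\<close>

lemma quantile_cdf_eq:
  assumes N: "real_distribution N" and cdf: "\<And>y. y \<in> {l<..<r} \<Longrightarrow> cdf N (\<phi> y) = F y"
    and F: "strict_mono_on {l<..<r} F" and cont: "isCont \<phi> x" and x: "x \<in> {l<..<r}"
  shows "quantile N (F x) = \<phi> (x::real)"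
proof -
  interpret N: real_distribution N by fact
  have "F x \<le> cdf N z \<longleftrightarrow> \<phi> x \<le> z" for z
  proof
    assume "\<phi> x \<le> z"
    then show "F x \<le> cdf N z" using N.cdf_nondecreasing[of "\<phi> x" z] cdf[OF x] by simp
  next
    assume le: "F x \<le> cdf N z"
    show "\<phi> x \<le> z"
    proof (rule ccontr)
      assume less: "\<not> \<phi> x \<le> z"
      then have "cdf N z = F x" using le N.cdf_nondecreasing[of z "\<phi> x"] cdf[OF x] by simp
      from cdf_eq_imp_eq[OF N cdf F cont x this] less show False by simp
    qed
  qed
  then have "{z. F x \<le> cdf N z} = {\<phi> x..}" by auto
  then show ?thesis by (simp add: quantile_def)
qed

section \<open>The midpoint map is not an affine shape map\<close>

lemma midpoint_not_affine_shape_map: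
  assumes "a \<noteq> 0" and "l < r"
    and eq: "\<And>y. y \<in> {l<..<r} \<Longrightarrow> (y + shape_map a y) / 2 = \<mu> + \<sigma> * shape_map b y"
  shows False
proof -
  have first: "(1 + exp (a * y)) / 2 = \<sigma> * exp (b * y)" if y: "y \<in> {l<..<r}" for y
  proof (rule DERIV_unique)
    show "((\<lambda>y. (y + shape_map a y) / 2) has_real_derivative (1 + exp (a * y)) / 2) (at y)"
      by (auto intro!: derivative_eq_intros has_real_derivative_shape_map)
    have "((\<lambda>y. \<mu> + \<sigma> * shape_map b y) has_real_derivative \<sigma> * exp (b * y)) (at y)"
      by (auto intro!: derivative_eq_intros has_real_derivative_shape_map)
    then show "((\<lambda>y. (y + shape_map a y) / 2) has_real_derivative \<sigma> * exp (b * y)) (at y)"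
      using eq by (rule has_field_derivative_transform_within_open
          [OF _ open_greaterThanLessThan y, OF _ sym])
  qed
  have second: "a * exp (a * y) / 2 = \<sigma> * (b * exp (b * y))" if y: "y \<in> {l<..<r}" for y
  proof (rule DERIV_unique)
    show "((\<lambda>y. (1 + exp (a * y)) / 2) has_real_derivative a * exp (a * y) / 2) (at y)"
      by (auto intro!: derivative_eq_intros)
    have "((\<lambda>y. \<sigma> * exp (b * y)) has_real_derivative \<sigma> * (b * exp (b * y))) (at y)"
      by (auto intro!: derivative_eq_intros)
    then show "((\<lambda>y. (1 + exp (a * y)) / 2) has_real_derivative \<sigma> * (b * exp (b * y))) (at y)"
      using first by (rule has_field_derivative_transform_within_open
          [OF _ open_greaterThanLessThan y, OF _ sym])
  qed
  \<comment> \<open>The right-hand side of \<open>second\<close> is b times that of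
    \<open>first\<close>; this eliminates \<sigma>.\<close>
  have key: "b = (a - b) * exp (a * y)" if y: "y \<in> {l<..<r}" for y
  proof -
    have "a * exp (a * y) / 2 = b * ((1 + exp (a * y)) / 2)"
      using first[OF y] second[OF y] by simp
    then show ?thesis by (simp add: algebra_simps)
  qed
  obtain x where x: "l < x" "x < r" using \<open>l < r\<close> dense by blast
  then obtain y where y: "x < y" "y < r" using dense by blast
  \<comment> \<open>The left-hand side of \<open>key\<close> is constant while the exponential is
    injective, so a = b; then \<open>key\<close> gives b = 0, against a being nonzero.\<close>
  have "(a - b) * exp (a * x) = (a - b) * exp (a * y)" using key[of x] key[of y] x y by simp
  then have "a = b" using \<open>a \<noteq> 0\<close> y by simp
  with key[of x] x \<open>a \<noteq> 0\<close> show False by simp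
qed

section \<open>Distribution function of the interpolation\<close>

text \<open>The interpolating map \<open>h\<close> preserves order relative to x up to a null set,
  so the mass it sends below \<open>h x\<close> is the mass originally below x; on the interval the
  transport map is \<phi>.\<close>

lemma cdf_displacement_interpolation:
  assumes f: "probability_density f" and N: "real_distribution N"
    and cdf: "\<And>y. y \<in> {l<..<r} \<Longrightarrow> cdf N (\<phi> y) = cdf (density_measure f) y"
    and pos: "\<And>x. x \<in> {l<..<r} \<Longrightarrow> 0 < f x" and cont: "isCont \<phi> x"
    and x: "x \<in> {l<..<r}" and t: "0 \<le> t" "t < 1"
  shows "cdf (displacement_interpolation (density_measure f) N t) ((1 - t) * x + t * \<phi> x)
    = cdf (density_measure f) x"
proof -
  define M where "M = density_measure f"
  have "prob_space M" using f by (simp add: probability_density_def M_def)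
  then interpret M: real_distribution M
    by (simp add: M_def real_distribution_def real_distribution_axioms_def)
  interpret N: real_distribution N by fact
  have F: "cdf M y < cdf M z" if "y \<in> {l<..<r}" "z \<in> {l<..<r}" "y < z" for y z
    unfolding M_def using cdf_density_measure_strict_mono[OF f pos that] .
  have "l < x" "x < r" using x by auto
  \<comment> \<open>Strict growth towards neighbours on both sides puts the level of x strictly
    between 0 and 1.\<close>
  obtain y where y: "l < y" "y < x" using dense[OF \<open>l < x\<close>] by blast
  obtain z where z: "x < z" "z < r" using dense[OF \<open>x < r\<close>] by blast
  have x0: "0 < cdf M x" using F[of y x] M.cdf_nonneg[of y] x y by simp
  have x1: "cdf M x < 1" using F[of x z] M.cdf_bounded_prob[of z] x z by simp
  define T where "T = transport_map M N"
  define h where "h y = (1 - t) * y + t * T y" for y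
  have "T x = \<phi> x"
    unfolding T_def transport_map_def comp_def
    by (rule quantile_cdf_eq[OF N _ _ cont x])
      (auto simp: M_def[symmetric] cdf intro!: strict_mono_onI F)
  have T_mono: "T u \<le> T v" if "u \<le> v" "0 < cdf M u" "cdf M v < 1" for u v
    unfolding T_def transport_map_def comp_def
    using that M.cdf_nondecreasing[OF that(1)] by (intro mono_onD[OF N.mono_on_quantile]) auto
  have [measurable]: "cdf M \<in> borel_measurable borel"
    by (intro borel_measurable_mono monoI M.cdf_nondecreasing)
  note N.borel_measurable_quantile [measurable]
  have [measurable]: "T \<in> borel_measurable borel"
    unfolding T_def transport_map_def by measurable
  have [measurable]: "h \<in> borel_measurable borel" unfolding h_def by measurable
  have M_cont: "isCont (cdf M) u" for u
    unfolding M_def using f by (rule isCont_cdf_density_measure)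
  have "AE u in M. h u \<le> h x \<longleftrightarrow> u \<le> x"
    using M.AE_cdf_pos[OF M_cont] M.AE_cdf_less_1[OF M_cont]
  proof eventually_elim
    case (elim u)
    show ?case
    proof (cases "u \<le> x")
      case True
      then show ?thesis using T_mono[of u x] elim x1 t
        by (auto simp: h_def intro!: add_mono mult_left_mono)
    next
      case False
      \<comment> \<open>The transport part is only weakly increasing; strictness comes from (1 - t)
        times the identity, with t < 1.\<close>
      then have "h x < h u" using T_mono[of x u] elim x0 t
        unfolding h_def by (intro add_less_le_mono mult_strict_left_mono mult_left_mono) auto
      with False show ?thesis by simp
    qed
  qed
  then have "measure M {u. h u \<le> h x} = measure M {u. u \<le> x}"
    by (intro M.finite_measure_eq_AE) auto
  then have "cdf (distr M borel h) (h x) = cdf M x"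
    by (simp add: cdf_def measure_distr vimage_def atMost_def)
  then show ?thesis
    using \<open>T x = \<phi> x\<close> by (simp add: displacement_interpolation_def h_def[abs_def] T_def M_def)
qed

section \<open>Contradiction from the midpoint of two members\<close>

theorem corollary3:
  fixes \<Xi> :: "real set" and f :: "real \<Rightarrow> real"
  assumes "open \<Xi>" and "0 \<in> \<Xi>"
    and "Ck_real 4 f" and "probability_density f"
    and "lss_model f \<Xi> \<subseteq> P2_space"
  shows "\<not> totally_geodesic (lss_model f \<Xi>)"
proof
  assume geo: "totally_geodesic (lss_model f \<Xi>)"
  have rd: "real_distribution N" if "N \<in> lss_model f \<Xi>" for N
    using that assms(5)
    by (auto simp: P2_space_def real_distribution_def real_distribution_axioms_def)
  obtain e where "e > 0" "ball 0 e \<subseteq> \<Xi>" using assms(1,2) openE by blast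
  \<comment> \<open>Openness of \<Xi> around 0 supplies a nonzero shape, here e / 2.\<close>
  then obtain a where a: "a \<noteq> 0" "a \<in> \<Xi>"
    by (intro that[of "e / 2"]) (auto simp: subset_iff dist_real_def)
  have f0: "\<And>x. 0 \<le> f x" and "prob_space (density_measure f)"
    using assms(4) by (auto simp: probability_density_def)
  then interpret M: prob_space "density_measure f" by simp
  have "(deriv ^^ 0) f differentiable_on UNIV"
    using assms(3) unfolding Ck_real_def by (metis zero_less_numeral)
  then have cont: "continuous_on UNIV f"
    by (simp add: differentiable_imp_continuous_on)
  \<comment> \<open>Total mass 1 gives a point where \<open>f\<close> is positive, and continuity
    widens it to an open interval.\<close>
  have "\<exists>x. f x \<noteq> 0"
  proof (rule ccontr)
    assume "\<nexists>x. f x \<noteq> 0"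
    then have "density_measure f = density lborel (\<lambda>_. 0)" by (simp add: density_measure_def)
    then show False using M.emeasure_space_1 by (simp add: emeasure_density)
  qed
  then obtain x0 where "0 < f x0" using f0 by (metis less_le)
  moreover have "open {x. 0 < f x}" using cont by (intro open_Collect_less) auto
  ultimately obtain d where d: "d > 0" "ball x0 d \<subseteq> {x. 0 < f x}"
    using openE[of "{x. 0 < f x}" x0] by auto
  define l r where "l = x0 - d" and "r = x0 + d"
  have "l < r" using d by (simp add: l_def r_def)
  have pos: "0 < f x" if "x \<in> {l<..<r}" for x
    using that d by (auto simp: l_def r_def subset_iff dist_real_def)
  define N where "N = density_measure (lss_density f 0 1 a)"
  have "density_measure f \<in> lss_model f \<Xi>"
    unfolding lss_model_def
    by (rule CollectI, intro exI[of _ 0] exI[of _ 1] conjI)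
      (use assms(2) in \<open>simp_all add: lss_density_standard\<close>)
  moreover have N: "N \<in> lss_model f \<Xi>"
    unfolding lss_model_def N_def
    by (rule CollectI, intro exI[of _ 0] exI[of _ 1] exI[of _ a] conjI) (use a in simp_all)
  ultimately have D: "displacement_interpolation (density_measure f) N (1/2) \<in> lss_model f \<Xi>"
    using geo by (auto simp: totally_geodesic_def)
  then obtain \<mu> \<sigma> b where b: "\<sigma> > 0"
    "displacement_interpolation (density_measure f) N (1/2) = density_measure (lss_density f \<mu> \<sigma> b)"
    unfolding lss_model_def by blast
  \<comment> \<open>Under the midpoint law both sides have the level of x under \<open>f\<close>:
    the right by membership in the model, the left by the interpolation formula. Strict growth on
    the interval forces them to coincide.\<close>
  have "(x + shape_map a x) / 2 = \<mu> + \<sigma> * shape_map b x" if x: "x \<in> {l<..<r}" for x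
  proof (rule cdf_eq_imp_eq[OF rd[OF D], where \<phi> = "\<lambda>y. \<mu> + \<sigma> * shape_map b y"
        and F = "cdf (density_measure f)" and l = l and r = r])
    show "cdf (displacement_interpolation (density_measure f) N (1/2)) (\<mu> + \<sigma> * shape_map b y)
      = cdf (density_measure f) y" for y
      unfolding b(2) using cdf_lss_density[OF assms(4) b(1)] .
    show "strict_mono_on {l<..<r} (cdf (density_measure f))"
      using cdf_density_measure_strict_mono[OF assms(4) pos] by (intro strict_mono_onI)
    show "isCont (\<lambda>y. \<mu> + \<sigma> * shape_map b y) x"
      by (intro continuous_intros isCont_shape_map)
    have "cdf N (shape_map a y) = cdf (density_measure f) y" for y
      using cdf_lss_density[OF assms(4), of 1 0 a y] by (simp add: N_def)
    from cdf_displacement_interpolation[OF assms(4) rd[OF N] this pos isCont_shape_map x, of "1/2"]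
    show "cdf (displacement_interpolation (density_measure f) N (1/2)) ((x + shape_map a x) / 2)
      = cdf (density_measure f) x"
      by (simp add: add_divide_distrib)
  qed (use x in auto)
  with \<open>a \<noteq> 0\<close> \<open>l < r\<close> show False by (rule midpoint_not_affine_shape_map)
qed

end
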